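(* Suppose that the semicontinuous-model assumption (conditions (A1)–(A5) of the context) holds, and that $v_t^\star$ is locally Lipschitz continuous on $\mathcal{Z}_t$ for each $t=0,\ldots,K$. Then $$|v_t^\star(x)-\tilde v_t(x)|\le\sum_{k=t+1}^K L_k\,\delta\qquad\text{for all }x\in\mathcal{Z}_t\text{ and all }t=0,\ldots,K,$$ where $L_k:=\sup_{j=1,\ldots,N_{\mathcal{C},k}}\ \sup_{x,x'\in\mathcal{C}_j,\ x\ne x'}\frac{|v_k^\star(x)-v_k^\star(x')|}{\|x-x'\|}$, and therefore $\tilde v_t$ converges uniformly to $v_t^\star$ on $\mathcal{Z}_t$ as $\delta\to0$.
   Context: Control problem. Let $K\ge 1$ be an integer, $\mathcal{X}\subseteq\mathbb{R}^n$, $\mathcal{U}\subseteq\mathbb{R}^m$, $\Xi\subseteq\mathbb{R}^l$ Borel sets, and for each $x\in\mathcal{X}$ let $\mathcal{U}(x)\subseteq\mathcal{U}$ be a nonempty Borel set of admissible actions; put $\mathcal{K}:=\{(x,u): x\in\mathcal{X},\,u\in\mathcal{U}(x)\}$. Let $f:\mathcal{X}\times\mathcal{U}\times\Xi\to\mathcal{X}$, $r:\mathcal{X}\times\mathcal{U}\to\mathbb{R}$ (stage cost) and $q:\mathcal{X}\to\mathbb{R}$ (terminal cost) be measurable. The system is $x_{t+1}=f(x_t,u_t,\xi_t)$ with i.i.d. disturbances $\xi_t$ distributed as $\xi$ with values in $\Xi$. Semicontinuous-model assumption: (A1) $\mathcal{U}(x)$ is compact for each $x\in\mathcal{X}$ and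 the multifunction $x\mapsto\mathcal{U}(x)$ is upper semicontinuous. (A2) $r$ and $q$ are lower semicontinuous on $\mathcal{K}$ and $\mathcal{X}$, respectively. (A3) There exist nonnegative constants $\bar r,\bar q,\beta$ with $\beta\ge1$ and a continuous function $w:\mathcal{X}\to[1,\infty)$ such that $|r(x,u)|\le\bar r w(x)$, $|q(x)|\le\bar q w(x)$ and $\mathbb{E}[w(f(x,u,\xi))]\le\beta w(x)$ for all $(x,u)\in\mathcal{K}$. (A4) $(x,u)\mapsto f(x,u,\boldsymbol{\xi})$ is continuous on $\mathcal{K}$ for each $\boldsymbol{\xi}\in\Xi$. (A5) $\Xi=\{\hat\xi^{[1]},\ldots,\hat\xi^{[N]}\}$ is finite. Write $p_s:=\mathrm{Prob}(\xi=\hat\xi^{[s]})$, $\sum_{s=1}^N p_s=1$, and $\mathcal{S}:=\{1,\ldots,N\}$. Discretization. $\mathcal{Z}_0\subseteq\mathcal{Z}_1\subseteq\cdots\subseteq\mathcal{Z}_K\subseteq\mathcal{X}$ are convex compact sets with $\{f(x,u,\boldsymbol{\xi}):x\in\mathcal{Z}_t,u\in\mathcal{U}(x),\boldsymbol{\xi}\in\Xi\}\subseteq\mathcal{Z}_{t+1}$ for $t=0,\ldots,K-1$. $\mathcal{C}_1,\ldots,\mathcal{C}_{N_{\mathcal{C}}}$ are convex compact subsets (cells) of $\mathcal{Z}_K$ with pairwise disjoint interiors, and there are $N_{\mathcal{C},0}\le\cdots\le N_{\mathcal{C},K}=N_{\mathcal{C}}$ with $\bigcup_{i=1}^{N_{\mathcal{C},t}}\mathcal{C}_i=\mathcal{Z}_t$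 for every $t$. Nodes $x^{[1]},\ldots,x^{[M_K]}\in\mathcal{Z}_K$ are chosen so that each $\mathcal{C}_i$ is the convex hull of a subset of the nodes, and $M_0\le\cdots\le M_K$ are such that $x^{[1]},\ldots,x^{[M_t]}$ are exactly the nodes lying in $\mathcal{Z}_t$. Set $\delta:=\max_{k}\max_{x^{[i]},x^{[j]}\in\mathcal{C}_k}\|x^{[i]}-x^{[j]}\|$. "As $\delta\to0$" means that the sets $\mathcal{Z}_t$ are fixed while cells and nodes vary so that $\delta\to0$. Optimal value function. $v_K^{opt}:=q$ and $v_t^{opt}(x):=\inf_{u\in\mathcal{U}(x)}\{r(x,u)+\sum_{s=1}^N p_s v_{t+1}^{opt}(f(x,u,\hat\xi^{[s]}))\}$ for $x\in\mathcal{X}$, $t=K-1,\ldots,0$ (this is the minimal expected cost-to-go $\inf_\pi\mathbb{E}^\pi[\sum_{k=t}^{K-1}r(x_k,u_k)+q(x_K)\mid x_t=x]$); $v_t^\star$ is the restriction of $v_t^{opt}$ to $\mathcal{Z}_t$. Bi-level approximate operator. For $y\in\mathcal{Z}_{t+1}$, $\mathcal{N}(y)$ denotes the set of (indices of) nodes lying in the cell $\mathcal{C}_j$, $j\le N_{\mathcal{C},t+1}$, that contains $y$ (if several cells contain $y$, one of them is selected by a fixed rule). For bounded $v:\mathcal{Z}_{t+1}\to\mathbb{R}$, $x\in\mathcal{Z}_t$, $u\in\mathcal{U}(x)$, with $y_s:=f(x,u,\hat\xi^{[s]})$, let $$(H_tv)(x,u):=\inf_\gamma\Big\{\sum_{s=1}^N\sum_{i\in\mathcal{N}(y_s)}p_s\gamma_{s,i}v(x^{[i]}):\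 y_s=\sum_{i\in\mathcal{N}(y_s)}\gamma_{s,i}x^{[i]},\ \gamma_s\in\Delta,\ \gamma_{s,i}=0\ \forall i\notin\mathcal{N}(y_s),\ \forall s\in\mathcal{S}\Big\},$$ where $\Delta:=\{\gamma\in\mathbb{R}^{M_{t+1}}:\sum_i\gamma_i=1,\gamma_i\ge0\}$, and $(\tilde T_tv)(x):=\inf_{u\in\mathcal{U}(x)}[r(x,u)+(H_tv)(x,u)]$. Define $\tilde v_K:=q$ on $\mathcal{Z}_K$ and $\tilde v_t:=\tilde T_t\tilde v_{t+1}$ on $\mathcal{Z}_t$ for $t=K-1,\ldots,0$. Conventions: a supremum over the empty set is $0$, an empty sum is $0$. *)

theory Defs
  imports "HOL-Probability.Probability"
begin

definition sup0 :: "real set \<Rightarrow> real" where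
  \<comment> \<open>supremum with the convention that it is 0 on the empty set;
    \<open>Sup {}\<close> is unspecified for type \<open>real\<close>\<close>
  "sup0 A = (if A = {} then 0 else Sup A)"

definition lower_semicontinuous_on :: "'a::topological_space set \<Rightarrow> ('a \<Rightarrow> real) \<Rightarrow> bool" where
  "lower_semicontinuous_on S f \<longleftrightarrow> (\<forall>x\<in>S. \<forall>c<f x. eventually (\<lambda>y. c < f y) (at x within S))"

definition upper_semicontinuous_multifunction_on ::
    "'a::topological_space set \<Rightarrow> ('a \<Rightarrow> 'b::topological_space set) \<Rightarrow> bool" where
  "upper_semicontinuous_multifunction_on S F \<longleftrightarrow>
     (\<forall>V. open V \<longrightarrow> openin (top_of_set S) {x\<in>S. F x \<subseteq> V})"

definition locally_lipschitz_on :: "'a::metric_space set \<Rightarrow> ('a \<Rightarrow> real) \<Rightarrow> bool" where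
  "locally_lipschitz_on S f \<longleftrightarrow> (\<forall>x\<in>S. \<exists>d>0. \<exists>L. lipschitz_on L (ball x d \<inter> S) f)"


subsection \<open>The control problem\<close>

record ('n::finite, 'm::finite, 'l::finite, 'w) control_data =
  horizon :: nat
  states :: "(real^'n) set"
  actions :: "(real^'m) set"
  disturbances :: "(real^'l) set"
  adm :: "real^'n \<Rightarrow> (real^'m) set"
  dyn :: "real^'n \<Rightarrow> real^'m \<Rightarrow> real^'l \<Rightarrow> real^'n"
  stage_cost :: "real^'n \<Rightarrow> real^'m \<Rightarrow> real"
  terminal_cost :: "real^'n \<Rightarrow> real"
  sample :: "'w measure"
  noise :: "nat \<Rightarrow> 'w \<Rightarrow> real^'l"
  num_scenarios :: nat
  scenario :: "nat \<Rightarrow> real^'l"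

definition admissible_pairs :: "('n::finite, 'm::finite, 'l::finite, 'w) control_data \<Rightarrow> ((real^'n) \<times> (real^'m)) set" where
  "admissible_pairs P = (SIGMA x:states P. adm P x)"

definition control_problem :: "('n::finite, 'm::finite, 'l::finite, 'w) control_data \<Rightarrow> bool" where
  \<comment> \<open>The disturbances \<open>noise P t\<close> are i.i.d.; \<open>noise P 0\<close> serves as their generic copy.\<close>
  "control_problem P \<longleftrightarrow>
     horizon P \<ge> 1 \<and>
     states P \<in> sets borel \<and> actions P \<in> sets borel \<and> disturbances P \<in> sets borel \<and>
     (\<forall>x\<in>states P. adm P x \<noteq> {} \<and> adm P x \<subseteq> actions P \<and> adm P x \<in> sets borel) \<and>
     (\<lambda>(x, u, e). dyn P x u e)
       \<in> restrict_space borel (states P \<times> actions P \<times> disturbances P) \<rightarrow>\<^sub>M restrict_space borel (states P) \<and>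
     (\<lambda>(x, u). stage_cost P x u) \<in> borel_measurable (restrict_space borel (states P \<times> actions P)) \<and>
     terminal_cost P \<in> borel_measurable (restrict_space borel (states P)) \<and>
     prob_space (sample P) \<and>
     prob_space.indep_vars (sample P) (\<lambda>_. borel) (noise P) {..<horizon P} \<and>
     (\<forall>t<horizon P. distr (sample P) borel (noise P t) = distr (sample P) borel (noise P 0)) \<and>
     (\<forall>t<horizon P. noise P t \<in> space (sample P) \<rightarrow> disturbances P)"

definition scenario_prob :: "('n::finite, 'm::finite, 'l::finite, 'w) control_data \<Rightarrow> nat \<Rightarrow> real" where
  "scenario_prob P s = measure (sample P) {\<omega>\<in>space (sample P). noise P 0 \<omega> = scenario P s}"

definition growth_condition :: "('n::finite, 'm::finite, 'l::finite, 'w) control_data \<Rightarrow> bool" where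
  "growth_condition P \<longleftrightarrow>
     (\<exists>rbar qbar \<beta> :: real. \<exists>w. 0 \<le> rbar \<and> 0 \<le> qbar \<and> 1 \<le> \<beta> \<and>
        continuous_on (states P) w \<and> (\<forall>x\<in>states P. 1 \<le> w x) \<and>
        (\<forall>(x, u)\<in>admissible_pairs P.
           \<bar>stage_cost P x u\<bar> \<le> rbar * w x \<and>
           \<bar>terminal_cost P x\<bar> \<le> qbar * w x \<and>
           prob_space.expectation (sample P) (\<lambda>\<omega>. w (dyn P x u (noise P 0 \<omega>))) \<le> \<beta> * w x))"

definition semicontinuous_model :: "('n::finite, 'm::finite, 'l::finite, 'w) control_data \<Rightarrow> bool" where
  "semicontinuous_model P \<longleftrightarrow>
     (\<forall>x\<in>states P. compact (adm P x)) \<and>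
     upper_semicontinuous_multifunction_on (states P) (adm P) \<and>
     lower_semicontinuous_on (admissible_pairs P) (\<lambda>(x, u). stage_cost P x u) \<and>
     lower_semicontinuous_on (states P) (terminal_cost P) \<and>
     growth_condition P \<and>
     (\<forall>e\<in>disturbances P. continuous_on (admissible_pairs P) (\<lambda>(x, u). dyn P x u e)) \<and>
     disturbances P = scenario P ` {1..num_scenarios P} \<and>
     (\<Sum>s = 1..num_scenarios P. scenario_prob P s) = 1"

function v_opt :: "('n::finite, 'm::finite, 'l::finite, 'w) control_data \<Rightarrow> nat \<Rightarrow> real^'n \<Rightarrow> real" where
  "v_opt P t =
     (if t < horizon P
      then (let v = v_opt P (Suc t) in
        (\<lambda>x. INF u\<in>adm P x. stage_cost P x u +
           (\<Sum>s = 1..num_scenarios P. scenario_prob P s * v (dyn P x u (scenario P s)))))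
      else terminal_cost P)"
  by pat_completeness auto
termination by (relation "Wellfounded.measure (\<lambda>(P, t). horizon P - t)") auto
declare v_opt.simps [simp del]


subsection \<open>Discretization\<close>

definition domain_sequence ::
    "('n::finite, 'm::finite, 'l::finite, 'w) control_data \<Rightarrow> (nat \<Rightarrow> (real^'n) set) \<Rightarrow> bool" where
  "domain_sequence P Z \<longleftrightarrow>
     (\<forall>t\<le>horizon P. convex (Z t) \<and> compact (Z t)) \<and>
     (\<forall>t<horizon P. Z t \<subseteq> Z (Suc t)) \<and>
     Z (horizon P) \<subseteq> states P \<and>
     (\<forall>t<horizon P. \<forall>x\<in>Z t. \<forall>u\<in>adm P x. \<forall>e\<in>disturbances P. dyn P x u e \<in> Z (Suc t))"

text \<open>
  Cells and nodes are numbered from 1; \<open>num_cells G t\<close> and \<open>num_nodes G t\<close> are the numbers of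
  cells and nodes in stage \<open>t\<close>, so the totals are their values at the horizon. The field
  \<open>sel G t y\<close> is the index of the cell selected for the point \<open>y\<close> of stage \<open>t\<close>.
\<close>

record 'n::finite grid =
  num_cells :: "nat \<Rightarrow> nat"
  cell :: "nat \<Rightarrow> (real^'n) set"
  num_nodes :: "nat \<Rightarrow> nat"
  node :: "nat \<Rightarrow> real^'n"
  sel :: "nat \<Rightarrow> real^'n \<Rightarrow> nat"

definition discretization ::
    "('n::finite, 'm::finite, 'l::finite, 'w) control_data \<Rightarrow> (nat \<Rightarrow> (real^'n) set) \<Rightarrow> 'n grid \<Rightarrow> bool" where
  "discretization P Z G \<longleftrightarrow> (let K = horizon P in
     (\<forall>i\<in>{1..num_cells G K}. convex (cell G i) \<and> compact (cell G i) \<and> cell G i \<subseteq> Z K) \<and>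
     disjoint_family_on (\<lambda>i. interior (cell G i)) {1..num_cells G K} \<and>
     (\<forall>t<K. num_cells G t \<le> num_cells G (Suc t)) \<and>
     (\<forall>t\<le>K. (\<Union>i\<in>{1..num_cells G t}. cell G i) = Z t) \<and>
     (\<forall>i\<in>{1..num_nodes G K}. node G i \<in> Z K) \<and>
     (\<forall>i\<in>{1..num_cells G K}. \<exists>I\<subseteq>{1..num_nodes G K}. cell G i = convex hull (node G ` I)) \<and>
     (\<forall>t<K. num_nodes G t \<le> num_nodes G (Suc t)) \<and>
     (\<forall>t\<le>K. {i\<in>{1..num_nodes G K}. node G i \<in> Z t} = {1..num_nodes G t}) \<and>
     (\<forall>t\<le>K. \<forall>y\<in>Z t. sel G t y \<in> {1..num_cells G t} \<and> y \<in> cell G (sel G t y)))"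

definition mesh :: "('n::finite, 'm::finite, 'l::finite, 'w) control_data \<Rightarrow> 'n grid \<Rightarrow> real" where
  "mesh P G = sup0 {norm (node G i - node G j) | i j k.
     k \<in> {1..num_cells G (horizon P)} \<and>
     i \<in> {1..num_nodes G (horizon P)} \<and> j \<in> {1..num_nodes G (horizon P)} \<and>
     node G i \<in> cell G k \<and> node G j \<in> cell G k}"

definition mesh_to_0 ::
    "('n::finite, 'm::finite, 'l::finite, 'w) control_data \<Rightarrow> (nat \<Rightarrow> (real^'n) set) \<Rightarrow> 'n grid filter" where
  "mesh_to_0 P Z = inf (filtercomap (mesh P) (nhds 0)) (principal {G. discretization P Z G})"

definition cell_nodes ::
    "('n::finite, 'm::finite, 'l::finite, 'w) control_data \<Rightarrow> 'n grid \<Rightarrow> nat \<Rightarrow> real^'n \<Rightarrow> nat set" where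
  "cell_nodes P G t y = {i\<in>{1..num_nodes G (horizon P)}. node G i \<in> cell G (sel G t y)}"

definition interp_weights ::
    "('n::finite, 'm::finite, 'l::finite, 'w) control_data \<Rightarrow> 'n grid \<Rightarrow> nat \<Rightarrow> real^'n \<Rightarrow> real^'m
      \<Rightarrow> (nat \<Rightarrow> nat \<Rightarrow> real) set" where
  "interp_weights P G t x u = {\<gamma>. \<forall>s\<in>{1..num_scenarios P}.
     (let y = dyn P x u (scenario P s); N = cell_nodes P G (Suc t) y in
        y = (\<Sum>i\<in>N. \<gamma> s i *\<^sub>R node G i) \<and>
        (\<forall>i\<in>{1..num_nodes G (Suc t)}. 0 \<le> \<gamma> s i) \<and>
        (\<Sum>i = 1..num_nodes G (Suc t). \<gamma> s i) = 1 \<and>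
        (\<forall>i\<in>{1..num_nodes G (Suc t)}. i \<notin> N \<longrightarrow> \<gamma> s i = 0))}"

definition interp_cost ::
    "('n::finite, 'm::finite, 'l::finite, 'w) control_data \<Rightarrow> 'n grid \<Rightarrow> nat \<Rightarrow> (real^'n \<Rightarrow> real)
      \<Rightarrow> real^'n \<Rightarrow> real^'m \<Rightarrow> real" where
  "interp_cost P G t v x u = (INF \<gamma>\<in>interp_weights P G t x u.
     \<Sum>s = 1..num_scenarios P. \<Sum>i\<in>cell_nodes P G (Suc t) (dyn P x u (scenario P s)).
       scenario_prob P s * \<gamma> s i * v (node G i))"

definition approx_bellman ::
    "('n::finite, 'm::finite, 'l::finite, 'w) control_data \<Rightarrow> 'n grid \<Rightarrow> nat \<Rightarrow> (real^'n \<Rightarrow> real)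
      \<Rightarrow> real^'n \<Rightarrow> real" where
  "approx_bellman P G t v x = (INF u\<in>adm P x. stage_cost P x u + interp_cost P G t v x u)"

text \<open>Only the values of \<open>v_approx P G t\<close> on the stage domain \<open>Z t\<close> are meaningful.\<close>

function v_approx ::
    "('n::finite, 'm::finite, 'l::finite, 'w) control_data \<Rightarrow> 'n grid \<Rightarrow> nat \<Rightarrow> real^'n \<Rightarrow> real" where
  "v_approx P G t =
     (if t < horizon P then approx_bellman P G t (v_approx P G (Suc t)) else terminal_cost P)"
  by pat_completeness auto
termination by (relation "Wellfounded.measure (\<lambda>(P, G, t). horizon P - t)") auto
declare v_approx.simps [simp del]

definition cell_lipschitz :: "'n::finite grid \<Rightarrow> nat \<Rightarrow> (real^'n \<Rightarrow> real) \<Rightarrow> real" where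
  "cell_lipschitz G k v = sup0 ((\<lambda>j. sup0 {\<bar>v x - v x'\<bar> / norm (x - x') | x x'.
     x \<in> cell G j \<and> x' \<in> cell G j \<and> x \<noteq> x'}) ` {1..num_cells G k})"

end

theory Submission
  imports Defs
begin

text \<open>
  Every feasible weight vector writes a successor state as a convex combination of the nodes of the
  cell containing it, and these nodes are at distance at most \<open>mesh P G\<close> from it. Interpolating the
  optimal value function of stage \<open>k\<close> therefore costs at most \<open>cell_lipschitz G k (v_opt P k) * mesh P G\<close>.
  Averages and infima do not increase a uniform error, so these one-step errors add up under backward
  induction. For the uniform limit, a locally Lipschitz function on a compact set is Lipschitz, which
  bounds the cell-wise Lipschitz constants independently of the grid.
\<close>

section \<open>Suprema, infima, averages and Lipschitz functions\<close>

lemma sup0_upper: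
  assumes "bdd_above A" "x \<in> A"
  shows "x \<le> sup0 A"
  using assms by (auto simp: sup0_def intro: cSup_upper)

lemma sup0_least:
  assumes "0 \<le> c" "\<And>x. x \<in> A \<Longrightarrow> x \<le> c"
  shows "sup0 A \<le> c"
  using assms by (auto simp: sup0_def intro: cSup_least)

lemma sup0_nonneg:
  assumes "bdd_above A" "\<And>x. x \<in> A \<Longrightarrow> 0 \<le> x"
  shows "0 \<le> sup0 A"
  using assms by (metis all_not_in_conv order.refl order_trans sup0_def sup0_upper)

text \<open>Shifting a lower bound of \<open>f\<close> down by \<open>B\<close> gives a lower bound
  of \<open>g\<close>, so both infima are genuine and each can be compared pointwise with the other
  function.\<close>

lemma abs_INF_diff_le:
  fixes f g :: "'a \<Rightarrow> real"
  assumes "A \<noteq> {}" and "bdd_below (f ` A)" and le: "\<And>a. a \<in> A \<Longrightarrow> \<bar>f a - g a\<bar> \<le> B"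
  shows "\<bar>(INF a\<in>A. f a) - (INF a\<in>A. g a)\<bar> \<le> B"
proof -
  obtain c where c: "\<And>a. a \<in> A \<Longrightarrow> c \<le> f a"
    using assms(2) by (auto simp: bdd_below_def)
  have bdd: "bdd_below (g ` A)"
  proof (rule bdd_belowI2)
    show "c - B \<le> g a" if "a \<in> A" for a
      using c[OF that] le[OF that] by linarith
  qed
  have "(INF a\<in>A. f a) - B \<le> (INF a\<in>A. g a)"
  proof (rule cINF_greatest[OF assms(1)])
    show "(INF a\<in>A. f a) - B \<le> g a" if "a \<in> A" for a
      using cINF_lower[OF assms(2) that] le[OF that] by linarith
  qed
  moreover have "(INF a\<in>A. g a) - B \<le> (INF a\<in>A. f a)"
  proof (rule cINF_greatest[OF assms(1)])
    show "(INF a\<in>A. g a) - B \<le> f a" if "a \<in> A" for a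
      using cINF_lower[OF bdd that] le[OF that] by linarith
  qed
  ultimately show ?thesis by linarith
qed

text \<open>As the weights sum to 1, \<open>c\<close> is its own weighted average, and the
  difference becomes an average of the terms \<open>c - f i\<close>. The lemma is applied both to
  the nodes of a cell and to the scenarios.\<close>

lemma abs_convex_sum_diff_le:
  fixes w f :: "'a \<Rightarrow> real"
  assumes "\<And>i. i \<in> I \<Longrightarrow> 0 \<le> w i" and "sum w I = 1" and "\<And>i. i \<in> I \<Longrightarrow> \<bar>c - f i\<bar> \<le> B"
  shows "\<bar>c - (\<Sum>i\<in>I. w i * f i)\<bar> \<le> B"
proof -
  have "c - (\<Sum>i\<in>I. w i * f i) = (\<Sum>i\<in>I. w i * (c - f i))"
    using assms(2) by (simp add: right_diff_distrib sum_subtractf flip: sum_distrib_right)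
  also have "\<bar>\<dots>\<bar> \<le> (\<Sum>i\<in>I. \<bar>w i * (c - f i)\<bar>)" by (rule sum_abs)
  also have "\<dots> \<le> (\<Sum>i\<in>I. w i * B)"
    using assms(1,3) by (intro sum_mono) (simp add: abs_mult mult_left_mono)
  also have "\<dots> = B"
    using assms(2) by (simp flip: sum_distrib_right)
  finally show ?thesis .
qed

text \<open>Viewing \<open>f\<close> as a time-dependent family over the single time 0 reduces the
  claim to the known compactness theorem for \<open>local_lipschitz\<close>.\<close>

lemma locally_lipschitz_on_compact:
  assumes "compact S" "locally_lipschitz_on S f"
  obtains L where "L-lipschitz_on S f"
proof -
  have "local_lipschitz {0::real} S (\<lambda>_. f)"
    unfolding local_lipschitz_def
  proof (intro ballI)
    fix x and t :: real assume "x \<in> S" "t \<in> {0}"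
    then obtain d L where "d > 0" and L: "L-lipschitz_on (ball x d \<inter> S) f"
      using assms(2) unfolding locally_lipschitz_on_def by blast
    \<comment> \<open>Halving the radius fits a closed ball, as \<open>local_lipschitz\<close>
      demands, into the given open one.\<close>
    have "L-lipschitz_on (cball x (d/2) \<inter> S) f"
      using L by (rule lipschitz_on_subset) (use \<open>d > 0\<close> in auto)
    then show "\<exists>u>0. \<exists>L. \<forall>s\<in>cball t u \<inter> {0}. L-lipschitz_on (cball x u \<inter> S) f"
      using \<open>d > 0\<close> by (intro exI[of _ "d/2"]) auto
  qed
  then obtain L where "\<And>t. t \<in> {0::real} \<Longrightarrow> L-lipschitz_on S f"
    by (rule local_lipschitz_compact_implies_lipschitz) (use assms(1) in auto)
  then show ?thesis using that by blast
qed

section \<open>Consequences of the model assumptions\<close>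

lemma domain_sequenceD:
  assumes "domain_sequence P Z"
  shows "\<forall>t\<le>horizon P. convex (Z t) \<and> compact (Z t)"
    and "\<forall>t<horizon P. Z t \<subseteq> Z (Suc t)"
    and "Z (horizon P) \<subseteq> states P"
    and "\<forall>t<horizon P. \<forall>x\<in>Z t. \<forall>u\<in>adm P x. \<forall>e\<in>disturbances P. dyn P x u e \<in> Z (Suc t)"
  by (insert assms[unfolded domain_sequence_def]) (elim conjE, assumption)+

lemma domain_subset_states:
  assumes "domain_sequence P Z" "t \<le> horizon P"
  shows "Z t \<subseteq> states P"
  using assms(2)
proof (induction t rule: inc_induct)
  case base
  show ?case using domain_sequenceD(3)[OF assms(1)] .
next
  case (step t)
  then show ?case using domain_sequenceD(2)[OF assms(1)] by blast
qed

lemma semicontinuous_modelD: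
  assumes "semicontinuous_model P"
  shows "growth_condition P"
    and "disturbances P = scenario P ` {1..num_scenarios P}"
    and "(\<Sum>s = 1..num_scenarios P. scenario_prob P s) = 1"
  by (insert assms[unfolded semicontinuous_model_def]) (elim conjE, assumption)+

text \<open>For fixed \<open>x\<close> the growth bound \<open>rbar * w x\<close> does not depend on
  \<open>u\<close>. This keeps the infimum over controls in the Bellman recursion bounded
  below.\<close>

lemma stage_cost_bounded:
  assumes "growth_condition P" "x \<in> states P"
  obtains R where "\<And>u. u \<in> adm P x \<Longrightarrow> \<bar>stage_cost P x u\<bar> \<le> R"
proof -
  obtain rbar w where "\<forall>(x, u)\<in>admissible_pairs P. \<bar>stage_cost P x u\<bar> \<le> rbar * w x"
    using assms(1) unfolding growth_condition_def by fast
  then have "\<bar>stage_cost P x u\<bar> \<le> rbar * w x" if "u \<in> adm P x" for u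
    using assms(2) that by (auto simp: admissible_pairs_def)
  then show ?thesis using that by blast
qed

section \<open>Geometry of cells and nodes, and existence of interpolation weights\<close>

context
  fixes P :: "('n::finite, 'm::finite, 'l::finite, 'w) control_data"
    and Z :: "nat \<Rightarrow> (real^'n) set"
    and G :: "'n grid"
  assumes disc: "discretization P Z G"
begin

lemma discretizationD:
  shows "\<forall>t\<le>horizon P. (\<Union>i\<in>{1..num_cells G t}. cell G i) = Z t"
    and "\<forall>t<horizon P. num_cells G t \<le> num_cells G (Suc t)"
    and "\<forall>i\<in>{1..num_cells G (horizon P)}. \<exists>I\<subseteq>{1..num_nodes G (horizon P)}. cell G i = convex hull (node G ` I)"
    and "\<forall>t\<le>horizon P. {i\<in>{1..num_nodes G (horizon P)}. node G i \<in> Z t} = {1..num_nodes G t}"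
    and "\<forall>t\<le>horizon P. \<forall>y\<in>Z t. sel G t y \<in> {1..num_cells G t} \<and> y \<in> cell G (sel G t y)"
  by (insert disc[unfolded discretization_def Let_def]) (elim conjE, assumption)+

lemma cell_subset_domain:
  assumes "t \<le> horizon P" "j \<in> {1..num_cells G t}"
  shows "cell G j \<subseteq> Z t"
  using discretizationD(1) assms by blast

lemma num_cells_le:
  assumes "t \<le> horizon P"
  shows "num_cells G t \<le> num_cells G (horizon P)"
  using assms
proof (induction t rule: inc_induct)
  case (step t)
  moreover have "num_cells G t \<le> num_cells G (Suc t)"
    using discretizationD(2) step.hyps by blast
  ultimately show ?case by simp
qed simp

lemma sel_cell:
  assumes "t \<le> horizon P" "y \<in> Z t"
  shows "sel G t y \<in> {1..num_cells G t}" "y \<in> cell G (sel G t y)"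
  using discretizationD(5) assms by blast+

text \<open>There are only finitely many pairs of nodes. Boundedness makes the supremum in
  \<open>mesh\<close> an actual upper bound.\<close>

lemma bdd_above_node_distances:
  "bdd_above {norm (node G i - node G j) | i j k.
     k \<in> {1..num_cells G (horizon P)} \<and>
     i \<in> {1..num_nodes G (horizon P)} \<and> j \<in> {1..num_nodes G (horizon P)} \<and>
     node G i \<in> cell G k \<and> node G j \<in> cell G k}" (is "bdd_above ?D")
proof -
  let ?I = "{1..num_nodes G (horizon P)}"
  have "?D \<subseteq> (\<lambda>(i, j). norm (node G i - node G j)) ` (?I \<times> ?I)"
    by auto
  then show ?thesis
    by (meson bdd_above_finite finite_SigmaI finite_atLeastAtMost finite_imageI finite_subset)
qed

lemma mesh_nonneg: "0 \<le> mesh P G"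
  unfolding mesh_def by (rule sup0_nonneg[OF bdd_above_node_distances]) auto

lemma node_dist_le_mesh:
  assumes "k \<in> {1..num_cells G (horizon P)}"
    and "i \<in> {1..num_nodes G (horizon P)}" "j \<in> {1..num_nodes G (horizon P)}"
    and "node G i \<in> cell G k" "node G j \<in> cell G k"
  shows "norm (node G i - node G j) \<le> mesh P G"
  unfolding mesh_def by (rule sup0_upper[OF bdd_above_node_distances]) (use assms in blast)

text \<open>The spanning nodes lie in their own hull, hence in the cell. Only an inclusion is
  claimed for \<open>I\<close>, since a cell may contain nodes beyond those chosen to span
  it.\<close>

lemma cell_eq_hull:
  assumes "t \<le> horizon P" "y \<in> Z t"
  obtains I where "I \<subseteq> cell_nodes P G t y" "cell G (sel G t y) = convex hull (node G ` I)"
proof -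
  have "sel G t y \<in> {1..num_cells G (horizon P)}"
    using sel_cell(1)[OF assms] num_cells_le[OF assms(1)] by auto
  then obtain I where "I \<subseteq> {1..num_nodes G (horizon P)}"
    "cell G (sel G t y) = convex hull (node G ` I)"
    using discretizationD(3) by blast
  moreover from this have "I \<subseteq> cell_nodes P G t y"
    using hull_subset[of "node G ` I" convex] by (auto simp: cell_nodes_def)
  ultimately show ?thesis using that by blast
qed

text \<open>The ball of radius \<open>mesh P G\<close> around a node of the cell contains all nodes
  of that cell. Being convex, it contains their hull, which is the whole cell.\<close>

lemma cell_nodes_dist:
  assumes "t \<le> horizon P" "y \<in> Z t" "i \<in> cell_nodes P G t y"
  shows "norm (y - node G i) \<le> mesh P G"
proof -
  have k: "sel G t y \<in> {1..num_cells G (horizon P)}"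
    using sel_cell(1)[OF assms(1,2)] num_cells_le[OF assms(1)] by auto
  obtain I where I: "I \<subseteq> cell_nodes P G t y" "cell G (sel G t y) = convex hull (node G ` I)"
    using cell_eq_hull[OF assms(1,2)] .
  have "node G ` I \<subseteq> cball (node G i) (mesh P G)"
  proof
    fix z assume "z \<in> node G ` I"
    then obtain j where j: "j \<in> cell_nodes P G t y" "z = node G j" using I by blast
    then show "z \<in> cball (node G i) (mesh P G)"
      using node_dist_le_mesh[OF k] assms(3) by (simp add: cell_nodes_def dist_norm)
  qed
  then have "convex hull (node G ` I) \<subseteq> cball (node G i) (mesh P G)"
    by (rule hull_minimal) simp
  then show ?thesis
    using sel_cell(2)[OF assms(1,2)] I(2) by (auto simp: dist_norm norm_minus_commute)
qed

text \<open>\<open>cell_nodes\<close> draws its indices from the full numbering at the horizon. The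
  selected cell is one of the cells covering \<open>Z t\<close>, so its nodes are already nodes of
  stage \<open>t\<close>.\<close>

lemma cell_nodes_in_domain:
  assumes "t \<le> horizon P" "y \<in> Z t" "i \<in> cell_nodes P G t y"
  shows "node G i \<in> Z t" "i \<in> {1..num_nodes G t}"
proof -
  show *: "node G i \<in> Z t"
    using cell_subset_domain[OF assms(1) sel_cell(1)[OF assms(1,2)]] assms(3)
    by (auto simp: cell_nodes_def)
  have "{i\<in>{1..num_nodes G (horizon P)}. node G i \<in> Z t} = {1..num_nodes G t}"
    using discretizationD(4) assms(1) by blast
  then show "i \<in> {1..num_nodes G t}"
    using * assms(3) by (auto simp: cell_nodes_def)
qed

text \<open>The selected cell is the hull of finitely many nodes, which gives convex weights,
  extended by zero to the other indices. The four conjuncts are the constraints that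
  \<open>interp_weights\<close> imposes for one scenario.\<close>

lemma barycentric_weights_exist:
  assumes "t \<le> horizon P" "y \<in> Z t"
  shows "\<exists>w. y = (\<Sum>i\<in>cell_nodes P G t y. w i *\<^sub>R node G i) \<and>
    (\<forall>i\<in>{1..num_nodes G t}. 0 \<le> w i) \<and> (\<Sum>i = 1..num_nodes G t. w i) = (1::real) \<and>
    (\<forall>i\<in>{1..num_nodes G t}. i \<notin> cell_nodes P G t y \<longrightarrow> w i = 0)"
proof -
  let ?N = "cell_nodes P G t y"
  have fin: "finite ?N" by (simp add: cell_nodes_def)
  obtain I where I: "I \<subseteq> ?N" "cell G (sel G t y) = convex hull (node G ` I)"
    using cell_eq_hull[OF assms] .
  have "finite (node G ` I)" using finite_subset[OF I(1) fin] by simp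
  then obtain a where a: "\<And>z. z \<in> node G ` I \<Longrightarrow> 0 \<le> a z" "sum a (node G ` I) = 1"
    "(\<Sum>z\<in>node G ` I. a z *\<^sub>R z) = y"
    using sel_cell(2)[OF assms] unfolding I(2) convex_hull_finite[OF \<open>finite (node G ` I)\<close>] by blast
  \<comment> \<open>Distinct indices may carry the same node, so one index per node is selected.\<close>
  obtain J where J: "J \<subseteq> I" "inj_on (node G) J" "node G ` I = node G ` J"
    using subset_image_inj[of "node G ` I" "node G" I] by auto
  define w where "w i = (if i \<in> J then a (node G i) else 0)" for i
  have JN: "J \<subseteq> ?N" using J I by blast
  have NM: "?N \<subseteq> {1..num_nodes G t}" using cell_nodes_in_domain(2)[OF assms] by blast
  have "(\<Sum>i\<in>?N. w i *\<^sub>R node G i) = (\<Sum>i\<in>J. a (node G i) *\<^sub>R node G i)"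
    by (rule sum.mono_neutral_cong_right[OF fin JN]) (auto simp: w_def)
  also have "\<dots> = y"
    using a(3) J by (simp add: sum.reindex)
  finally have 1: "y = (\<Sum>i\<in>?N. w i *\<^sub>R node G i)" by simp
  have "(\<Sum>i = 1..num_nodes G t. w i) = (\<Sum>i\<in>J. a (node G i))"
    by (rule sum.mono_neutral_cong_right) (use JN NM in \<open>auto simp: w_def\<close>)
  also have "\<dots> = 1"
    using a(2) J by (simp add: sum.reindex)
  finally have 2: "(\<Sum>i = 1..num_nodes G t. w i) = 1" .
  have "0 \<le> w i" for i
    using a(1) J(1) by (auto simp: w_def)
  moreover have "w i = 0" if "i \<notin> ?N" for i
    using that JN by (auto simp: w_def)
  ultimately show ?thesis using 1 2 by blast
qed

text \<open>The constraints decouple over the scenarios, so weights can be chosen separately for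
  each. Nonemptiness is what gives the infimum in \<open>interp_cost\<close> a meaning.\<close>

lemma interp_weights_nonempty:
  assumes "t < horizon P"
    and "\<And>s. s \<in> {1..num_scenarios P} \<Longrightarrow> dyn P x u (scenario P s) \<in> Z (Suc t)"
  shows "interp_weights P G t x u \<noteq> {}"
proof -
  let ?y = "\<lambda>s. dyn P x u (scenario P s)"
  have "\<forall>s\<in>{1..num_scenarios P}. \<exists>w. ?y s = (\<Sum>i\<in>cell_nodes P G (Suc t) (?y s). w i *\<^sub>R node G i) \<and>
    (\<forall>i\<in>{1..num_nodes G (Suc t)}. 0 \<le> w i) \<and> (\<Sum>i = 1..num_nodes G (Suc t). w i) = (1::real) \<and>
    (\<forall>i\<in>{1..num_nodes G (Suc t)}. i \<notin> cell_nodes P G (Suc t) (?y s) \<longrightarrow> w i = 0)"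
    using assms by (intro ballI barycentric_weights_exist) auto
  from bchoice[OF this] obtain \<gamma> where "\<gamma> \<in> interp_weights P G t x u"
    unfolding interp_weights_def Let_def by blast
  then show ?thesis by blast
qed

section \<open>Cell-wise Lipschitz constants\<close>

lemma lipschitz_quotient_le:
  assumes "L-lipschitz_on (Z k) v" "k \<le> horizon P" "j \<in> {1..num_cells G k}"
    and "x \<in> cell G j" "x' \<in> cell G j"
  shows "\<bar>v x - v x'\<bar> / norm (x - x') \<le> L"
proof (cases "x = x'")
  case True
  \<comment> \<open>Division by zero yields 0 here, so the claim reduces to nonnegativity of
    \<open>L\<close>.\<close>
  then show ?thesis using lipschitz_on_nonneg[OF assms(1)] by simp
next
  case False
  have "\<bar>v x - v x'\<bar> \<le> L * norm (x - x')"
    using lipschitz_onD[OF assms(1), of x x'] cell_subset_domain[OF assms(2,3)] assms(4,5)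
    by (auto simp: dist_norm)
  then show ?thesis using False by (simp add: divide_le_eq)
qed

text \<open>This bound is independent of the grid, which the uniform limit requires. Nonnegativity
  of \<open>L\<close> covers empty suprema, whose value is 0.\<close>

lemma cell_lipschitz_le:
  assumes "L-lipschitz_on (Z k) v" "k \<le> horizon P"
  shows "cell_lipschitz G k v \<le> L"
proof -
  have "0 \<le> L" using lipschitz_on_nonneg[OF assms(1)] .
  show ?thesis
    unfolding cell_lipschitz_def
    by (rule sup0_least[OF \<open>0 \<le> L\<close>], clarify, rule sup0_least[OF \<open>0 \<le> L\<close>])
      (use lipschitz_quotient_le[OF assms] in blast)
qed

text \<open>The constant \<open>L\<close> guarantees that the difference quotients on a cell are
  bounded, so that their supremum dominates each of them. The outer supremum runs over finitely many
  cells.\<close>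

lemma cell_lipschitz_bound:
  assumes "L-lipschitz_on (Z k) v" "k \<le> horizon P" "j \<in> {1..num_cells G k}"
    and "x \<in> cell G j" "x' \<in> cell G j" "norm (x - x') \<le> d"
  shows "\<bar>v x - v x'\<bar> \<le> cell_lipschitz G k v * d"
proof -
  let ?Q = "\<lambda>j. {\<bar>v x - v x'\<bar> / norm (x - x') | x x'. x \<in> cell G j \<and> x' \<in> cell G j \<and> x \<noteq> x'}"
  have bdd: "bdd_above (?Q j)"
    by (rule bdd_aboveI[of _ L]) (use lipschitz_quotient_le[OF assms(1-3)] in blast)
  have "sup0 (?Q j) \<le> cell_lipschitz G k v"
    unfolding cell_lipschitz_def
    by (rule sup0_upper) (use assms(3) in \<open>auto intro!: bdd_above_finite\<close>)
  \<comment> \<open>This includes a one-point cell: its set of quotients is empty and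
    \<open>sup0\<close> returns 0.\<close>
  moreover have "0 \<le> sup0 (?Q j)"
    by (rule sup0_nonneg[OF bdd]) auto
  ultimately have nn: "0 \<le> cell_lipschitz G k v" by linarith
  show ?thesis
  proof (cases "x = x'")
    case True
    then show ?thesis using nn assms(6) by simp
  next
    case False
    then have "\<bar>v x - v x'\<bar> / norm (x - x') \<in> ?Q j"
      using assms(4,5) by blast
    from sup0_upper[OF bdd this] have "\<bar>v x - v x'\<bar> / norm (x - x') \<le> cell_lipschitz G k v"
      using \<open>sup0 (?Q j) \<le> _\<close> by linarith
    then have "\<bar>v x - v x'\<bar> \<le> cell_lipschitz G k v * norm (x - x')"
      using False by (simp add: divide_le_eq)
    also have "\<dots> \<le> cell_lipschitz G k v * d"
      using nn assms(6) by (rule mult_left_mono[rotated])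
    finally show ?thesis .
  qed
qed

section \<open>One-step error and backward induction\<close>

text \<open>For each scenario and each node of the selected cell, moving from the successor state to
  the node costs the Lipschitz term, and replacing \<open>v\<close> by \<open>v'\<close> there costs
  \<open>E\<close>. The bound survives both averages for every feasible weight, hence also the
  infimum.\<close>

lemma interp_cost_error:
  assumes "t < horizon P"
    and y: "\<And>s. s \<in> {1..num_scenarios P} \<Longrightarrow> dyn P x u (scenario P s) \<in> Z (Suc t)"
    and p: "(\<Sum>s = 1..num_scenarios P. scenario_prob P s) = 1"
    and lip: "L-lipschitz_on (Z (Suc t)) v"
    and err: "\<And>z. z \<in> Z (Suc t) \<Longrightarrow> \<bar>v z - v' z\<bar> \<le> E"
  shows "\<bar>(\<Sum>s = 1..num_scenarios P. scenario_prob P s * v (dyn P x u (scenario P s)))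
      - interp_cost P G t v' x u\<bar> \<le> cell_lipschitz G (Suc t) v * mesh P G + E"
proof -
  let ?y = "\<lambda>s. dyn P x u (scenario P s)"
  let ?N = "\<lambda>s. cell_nodes P G (Suc t) (?y s)"
  let ?c = "\<Sum>s = 1..num_scenarios P. scenario_prob P s * v (?y s)"
  let ?B = "cell_lipschitz G (Suc t) v * mesh P G + E"
  have t: "Suc t \<le> horizon P" using assms(1) by simp
  have ne: "interp_weights P G t x u \<noteq> {}"
    by (rule interp_weights_nonempty[OF assms(1) y])
  have node_err: "\<bar>v (?y s) - v' (node G i)\<bar> \<le> ?B"
    if s: "s \<in> {1..num_scenarios P}" and i: "i \<in> ?N s" for s i
  proof -
    have "\<bar>v (?y s) - v (node G i)\<bar> \<le> cell_lipschitz G (Suc t) v * mesh P G"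
      using cell_lipschitz_bound[OF lip t sel_cell[OF t y[OF s]]] cell_nodes_dist[OF t y[OF s] i] i
      by (simp add: cell_nodes_def)
    moreover have "\<bar>v (node G i) - v' (node G i)\<bar> \<le> E"
      using err cell_nodes_in_domain(1)[OF t y[OF s] i] by blast
    ultimately show ?thesis by linarith
  qed
  have "\<bar>?c - (\<Sum>s = 1..num_scenarios P. \<Sum>i\<in>?N s. scenario_prob P s * \<gamma> s i * v' (node G i))\<bar> \<le> ?B"
    if \<gamma>: "\<gamma> \<in> interp_weights P G t x u" for \<gamma>
  proof -
    have "\<bar>v (?y s) - (\<Sum>i\<in>?N s. \<gamma> s i * v' (node G i))\<bar> \<le> ?B"
      if s: "s \<in> {1..num_scenarios P}" for s
    proof (rule abs_convex_sum_diff_le)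
      have sub: "?N s \<subseteq> {1..num_nodes G (Suc t)}"
        using cell_nodes_in_domain(2)[OF t y[OF s]] by blast
      show "0 \<le> \<gamma> s i" if "i \<in> ?N s" for i
        using \<gamma> s sub that unfolding interp_weights_def Let_def by blast
      \<comment> \<open>Feasibility normalizes the weights over all nodes of the stage; those
        outside the cell vanish.\<close>
      have "sum (\<gamma> s) (?N s) = (\<Sum>i = 1..num_nodes G (Suc t). \<gamma> s i)"
        by (rule sum.mono_neutral_left)
          (use \<gamma> s sub in \<open>auto simp: interp_weights_def Let_def\<close>)
      then show "sum (\<gamma> s) (?N s) = 1"
        using \<gamma> s by (simp add: interp_weights_def Let_def)
    qed (rule node_err[OF s])
    note inner = this
    \<comment> \<open>Writing the difference as 0 minus an average over the scenarios allows the
      averaging lemma to be used with \<open>c = 0\<close>.\<close>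
    have "?c - (\<Sum>s = 1..num_scenarios P. \<Sum>i\<in>?N s. scenario_prob P s * \<gamma> s i * v' (node G i))
      = 0 - (\<Sum>s = 1..num_scenarios P. scenario_prob P s *
          ((\<Sum>i\<in>?N s. \<gamma> s i * v' (node G i)) - v (?y s)))"
      by (simp add: sum_distrib_left right_diff_distrib sum_subtractf mult.assoc)
    also have "\<bar>\<dots>\<bar> \<le> ?B"
    proof (rule abs_convex_sum_diff_le[OF _ p])
      show "\<bar>0 - ((\<Sum>i\<in>?N s. \<gamma> s i * v' (node G i)) - v (?y s))\<bar> \<le> ?B"
        if "s \<in> {1..num_scenarios P}" for s
        using inner[OF that] by simp
    qed (simp add: scenario_prob_def)
    finally show ?thesis .
  qed
  \<comment> \<open>The number \<open>?c\<close> is read as the infimum of a constant family over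
    the nonempty weight set, so that two infima are compared.\<close>
  then have "\<bar>(INF \<gamma>\<in>interp_weights P G t x u. ?c) - interp_cost P G t v' x u\<bar> \<le> ?B"
    unfolding interp_cost_def by (intro abs_INF_diff_le ne) (auto simp: ne)
  then show ?thesis using ne by simp
qed

theorem v_approx_error:
  assumes cp: "control_problem P" and sm: "semicontinuous_model P"
    and dom: "domain_sequence P Z"
    and lip: "\<And>t. t \<le> horizon P \<Longrightarrow> locally_lipschitz_on (Z t) (v_opt P t)"
    and "t \<le> horizon P" "x \<in> Z t"
  shows "\<bar>v_opt P t x - v_approx P G t x\<bar>
    \<le> (\<Sum>k = t + 1..horizon P. cell_lipschitz G k (v_opt P k) * mesh P G)"
  using assms(5,6)
proof (induction t arbitrary: x rule: inc_induct)
  case base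
  \<comment> \<open>Both functions equal the terminal cost, and the sum of errors is empty.\<close>
  then show ?case by (simp add: v_opt.simps[of P "horizon P"] v_approx.simps[of P G "horizon P"])
next
  case (step t)
  let ?E = "\<Sum>k = Suc t + 1..horizon P. cell_lipschitz G k (v_opt P k) * mesh P G"
  have t: "t < horizon P" "Suc t \<le> horizon P" using step.hyps by auto
  have x: "x \<in> states P"
    using domain_subset_states[OF dom less_imp_le[OF t(1)]] step.prems by blast
  have ne: "adm P x \<noteq> {}"
  proof -
    have "\<forall>x\<in>states P. adm P x \<noteq> {} \<and> adm P x \<subseteq> actions P \<and> adm P x \<in> sets borel"
      by (insert cp[unfolded control_problem_def]) (elim conjE, assumption)
    then show ?thesis using x by blast
  qed
  have y: "dyn P x u (scenario P s) \<in> Z (Suc t)"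
    if "u \<in> adm P x" "s \<in> {1..num_scenarios P}" for u s
  proof -
    have "scenario P s \<in> disturbances P"
      using semicontinuous_modelD(2)[OF sm] that(2) by blast
    then show ?thesis
      using domain_sequenceD(4)[OF dom] t(1) step.prems that(1) by blast
  qed
  note p = semicontinuous_modelD(3)[OF sm]
  have comp: "compact (Z (Suc t))"
    using domain_sequenceD(1)[OF dom] t(2) by blast
  obtain L where L: "L-lipschitz_on (Z (Suc t)) (v_opt P (Suc t))"
    using locally_lipschitz_on_compact[OF comp lip[OF t(2)]] .
  have "compact (v_opt P (Suc t) ` Z (Suc t))"
    using comp lipschitz_on_continuous_on[OF L] by (rule compact_continuous_image[rotated])
  then obtain C where C: "\<And>z. z \<in> Z (Suc t) \<Longrightarrow> \<bar>v_opt P (Suc t) z\<bar> \<le> C"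
    using compact_imp_bounded[of "v_opt P (Suc t) ` Z (Suc t)"] unfolding bounded_iff by auto
  obtain R where R: "\<And>u. u \<in> adm P x \<Longrightarrow> \<bar>stage_cost P x u\<bar> \<le> R"
    using stage_cost_bounded[OF semicontinuous_modelD(1)[OF sm] x] by blast
  let ?S = "\<lambda>u. \<Sum>s = 1..num_scenarios P. scenario_prob P s * v_opt P (Suc t) (dyn P x u (scenario P s))"
  \<comment> \<open>The Bellman infimum is finite: the stage cost is bounded by \<open>R\<close>,
    and an average of values of \<open>v_opt\<close> on the compact next domain is bounded by
    \<open>C\<close>.\<close>
  have bdd: "bdd_below ((\<lambda>u. stage_cost P x u + ?S u) ` adm P x)"
  proof (rule bdd_belowI2)
    fix u assume u: "u \<in> adm P x"
    have "\<bar>0 - ?S u\<bar> \<le> C"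
      by (rule abs_convex_sum_diff_le[OF _ p])
        (use C y[OF u] in \<open>auto simp: scenario_prob_def\<close>)
    then show "- R - C \<le> stage_cost P x u + ?S u"
      using R[OF u] by linarith
  qed
  have "\<bar>(INF u\<in>adm P x. stage_cost P x u + ?S u)
      - (INF u\<in>adm P x. stage_cost P x u + interp_cost P G t (v_approx P G (Suc t)) x u)\<bar>
    \<le> cell_lipschitz G (Suc t) (v_opt P (Suc t)) * mesh P G + ?E"
  proof (rule abs_INF_diff_le[OF ne bdd])
    fix u assume u: "u \<in> adm P x"
    show "\<bar>stage_cost P x u + ?S u
        - (stage_cost P x u + interp_cost P G t (v_approx P G (Suc t)) x u)\<bar>
      \<le> cell_lipschitz G (Suc t) (v_opt P (Suc t)) * mesh P G + ?E"
      using interp_cost_error[OF t(1) y[OF u] p L step.IH] by simp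
  qed
  moreover have "(\<Sum>k = t + 1..horizon P. cell_lipschitz G k (v_opt P k) * mesh P G)
      = cell_lipschitz G (Suc t) (v_opt P (Suc t)) * mesh P G + ?E"
    using t(2) by (simp add: sum.atLeast_Suc_atMost)
  ultimately show ?case
    using t(1) by (simp add: v_opt.simps[of P t] v_approx.simps[of P G t] approx_bellman_def Let_def)
qed

end

section \<open>Uniform convergence as the mesh tends to 0\<close>

lemma eventually_mesh_to_0:
  assumes "0 < d"
  shows "\<forall>\<^sub>F G in mesh_to_0 P Z. discretization P Z G \<and> \<bar>mesh P G\<bar> < d"
proof -
  have "\<forall>\<^sub>F m in nhds 0. \<bar>m\<bar> < d"
    using assms by (auto simp: eventually_nhds_metric)
  then have "\<forall>\<^sub>F G in filtercomap (mesh P) (nhds 0). \<bar>mesh P G\<bar> < d"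
    by (rule eventually_filtercomapI)
  then show ?thesis
    unfolding mesh_to_0_def eventually_inf_principal by (rule eventually_mono) simp
qed

theorem theorem3:
  fixes P :: "('n::finite, 'm::finite, 'l::finite, 'w) control_data"
    and Z :: "nat \<Rightarrow> (real^'n) set"
  assumes "control_problem P"
    and "semicontinuous_model P"
    and "domain_sequence P Z"
    and "\<forall>t\<le>horizon P. locally_lipschitz_on (Z t) (v_opt P t)"
  shows "(\<forall>G. discretization P Z G \<longrightarrow>
            (\<forall>t\<le>horizon P. \<forall>x\<in>Z t.
               \<bar>v_opt P t x - v_approx P G t x\<bar>
                 \<le> (\<Sum>k = t + 1..horizon P. cell_lipschitz G k (v_opt P k) * mesh P G))) \<and>
         (\<forall>t\<le>horizon P. uniform_limit (Z t) (\<lambda>G. v_approx P G t) (v_opt P t) (mesh_to_0 P Z))"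
proof (intro conjI allI impI)
  have bound: "\<bar>v_opt P t x - v_approx P G t x\<bar>
      \<le> (\<Sum>k = t + 1..horizon P. cell_lipschitz G k (v_opt P k) * mesh P G)"
    if "discretization P Z G" "t \<le> horizon P" "x \<in> Z t" for G t x
    using v_approx_error[OF that(1) assms(1-3) _ that(2,3)] assms(4) by blast
  then show "\<forall>x\<in>Z t. \<bar>v_opt P t x - v_approx P G t x\<bar>
      \<le> (\<Sum>k = t + 1..horizon P. cell_lipschitz G k (v_opt P k) * mesh P G)"
    if "discretization P Z G" "t \<le> horizon P" for G t
    using that by blast
  \<comment> \<open>These constants depend on the fixed domains alone and will dominate
    \<open>cell_lipschitz G k (v_opt P k)\<close> for every discretization \<open>G\<close>.\<close>
  have "\<exists>L. L-lipschitz_on (Z k) (v_opt P k)" if "k \<le> horizon P" for k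
    using locally_lipschitz_on_compact[of "Z k" "v_opt P k"] domain_sequenceD(1)[OF assms(3)]
      assms(4) that by blast
  then obtain \<Lambda> where \<Lambda>: "\<And>k. k \<le> horizon P \<Longrightarrow> (\<Lambda> k)-lipschitz_on (Z k) (v_opt P k)"
    by metis
  show "uniform_limit (Z t) (\<lambda>G. v_approx P G t) (v_opt P t) (mesh_to_0 P Z)"
    if t: "t \<le> horizon P" for t
  proof (rule uniform_limitI)
    fix e :: real assume "0 < e"
    let ?C = "\<Sum>k = t + 1..horizon P. \<Lambda> k"
    have C: "0 \<le> ?C"
      using lipschitz_on_nonneg[OF \<Lambda>] by (auto intro: sum_nonneg)
    \<comment> \<open>Adding 1 keeps the denominator positive when \<open>?C\<close> is 0, for
      instance at \<open>t = horizon P\<close>, where the sum is empty.\<close>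
    have "0 < e / (?C + 1)" using \<open>0 < e\<close> C by simp
    from eventually_mesh_to_0[OF this]
    show "\<forall>\<^sub>F G in mesh_to_0 P Z. \<forall>x\<in>Z t. dist (v_approx P G t x) (v_opt P t x) < e"
    proof (rule eventually_mono, intro ballI)
      fix G x assume G: "discretization P Z G \<and> \<bar>mesh P G\<bar> < e / (?C + 1)" and "x \<in> Z t"
      have m: "0 \<le> mesh P G" using mesh_nonneg[of P Z G] G by blast
      have "dist (v_approx P G t x) (v_opt P t x)
          \<le> (\<Sum>k = t + 1..horizon P. cell_lipschitz G k (v_opt P k) * mesh P G)"
        using bound[of G t x] G t \<open>x \<in> Z t\<close> by (simp add: dist_real_def abs_minus_commute)
      also have "\<dots> \<le> (\<Sum>k = t + 1..horizon P. \<Lambda> k * mesh P G)"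
        using cell_lipschitz_le[of P Z G] G \<Lambda> m by (intro sum_mono mult_right_mono) auto
      also have "\<dots> = ?C * mesh P G" by (simp add: sum_distrib_right)
      also have "\<dots> \<le> (?C + 1) * mesh P G" using m by (simp add: distrib_right)
      also have "\<dots> < e" using G C m by (simp add: field_simps)
      finally show "dist (v_approx P G t x) (v_opt P t x) < e" .
    qed
  qed
qed

end
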